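(* Let $n\geq 1$ and $k\geq 2$ be integers, and let $\phi\colon\mathbb{P}^{n(n+3)/2}\dashrightarrow\mathbb{P}^{n(n+3)/2}$ be the Cremona transformation given on $\{x_{00}\neq0\}$, with $x_{00}=1$, by $$y_{0i}=x_{0i}\quad(1\leq i\leq n),\qquad y_{ij}=x_{ij}-x_{0i}x_{0j}\quad(1\leq i\leq j\leq n).$$ Then $\phi$ maps the $(k-1)$-secant variety $\mathrm{Sec}_{k-1}(V_{2,n})$ of the $2$-Veronese variety $V_{2,n}$ to the cone over the $(k-2)$-secant variety $\mathrm{Sec}_{k-2}(V_{2,n-1})$ of $V_{2,n-1}$, where $V_{2,n-1}$ lies in the projective space with homogeneous coordinates $[y_{ij}]_{1\leq i\leq j\leq n}$, and the vertex of the cone is the linear image $\{y_{ij}=0: 1\leq i\leq j\leq n\}$ of $V_{2,n}$ under $\phi$.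
   Context: Everything is over $\mathbb{C}$. $\mathbb{P}^{n(n+3)/2}$ has homogeneous coordinates $[x_{ij}]_{0\leq i\leq j\leq n}$ (source) and $[y_{ij}]_{0\leq i\leq j\leq n}$ (target), and is identified with the space of nonzero symmetric $(n+1)\times(n+1)$ matrices modulo nonzero scalars by setting $x_{ji}=x_{ij}$. $V_{2,n}$ is the locus of symmetric matrices of rank $1$ ($V_{2,0}$ is a point, equal to $\mathbb{P}^0$). In homogeneous coordinates $\phi$ reads $y_{00}=x_{00}^2$, $y_{0i}=x_{00}x_{0i}$, $y_{ij}=x_{00}x_{ij}-x_{0i}x_{0j}$. For $X\subset\mathbb{P}^N$ and $k\geq 0$, the $k$-secant variety $\mathrm{Sec}_k(X)$ is the Zariski closure of the union of all linear spaces of dimension $k$ that contain $k+1$ linearly independent points of $X$ (so $\mathrm{Sec}_0(X)=X$); for nondegenerate $X$ and $k\geq N$ it is understood to be $\mathbb{P}^N$. The image of a variety under $\phi$ is the Zariski closure of the image of its intersection with $\{x_{00}\neq 0\}$. The cone over a subvariety $W$ of the projective space with coordinates $[y_{ij}]_{1\leq i\leq j\leq n}$ with vertex $L=\{y_{ij}=0:1\leq i\leq j\leq n\}$ is the set of points of $\mathbb{P}^{n(n+3)/2}$ that either lie in $L$ or satisfy $[y_{ij}]_{1\leq i\leq j\leq n}\in W$. *)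

theory Defs
  imports
    Complex_Main
    "HOL-Library.Poly_Mapping"
    "HOL-Library.Function_Algebras"
    "Jordan_Normal_Form.DL_Rank"
begin

text \<open>
  A point of the projective space with homogeneous coordinates indexed by a finite set
  \<open>I :: 'i set\<close> is a class, modulo nonzero scalars, of nonzero functions \<open>'i \<Rightarrow> complex\<close>
  that vanish outside \<open>I\<close>. Projective spaces of all dimensions thus live in one type, with
  the index set (and hence the dimension \<open>card I - 1\<close>) as an ordinary parameter.
\<close>

definition scale_fun :: "complex \<Rightarrow> ('i \<Rightarrow> complex) \<Rightarrow> 'i \<Rightarrow> complex" where
  "scale_fun c x = (\<lambda>i. c * x i)"

global_interpretation cfun: vector_space scale_fun
  by unfold_locales (auto simp: scale_fun_def fun_eq_iff algebra_simps)

definition coord_space :: "'i set \<Rightarrow> ('i \<Rightarrow> complex) set" where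
  "coord_space I = {x. \<forall>i. i \<notin> I \<longrightarrow> x i = 0}"

definition proj_rel :: "'i set \<Rightarrow> (('i \<Rightarrow> complex) \<times> ('i \<Rightarrow> complex)) set" where
  "proj_rel I = {(x, y). x \<in> coord_space I - {0} \<and> y \<in> coord_space I - {0} \<and>
     (\<exists>c. c \<noteq> 0 \<and> y = scale_fun c x)}"

definition proj_space :: "'i set \<Rightarrow> ('i \<Rightarrow> complex) set set" where
  "proj_space I = (coord_space I - {0}) // proj_rel I"

definition proj_point :: "'i set \<Rightarrow> ('i \<Rightarrow> complex) \<Rightarrow> ('i \<Rightarrow> complex) set" where
  "proj_point I x = proj_rel I `` {x}"

text \<open>
  A polynomial in the variables \<open>X\<^sub>i\<close> (\<open>i :: 'i\<close>) maps monomials, i.e. finitely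
  supported exponent functions \<open>'i \<Rightarrow>\<^sub>0 nat\<close>, to coefficients.
\<close>

type_synonym 'i cpoly = "('i \<Rightarrow>\<^sub>0 nat) \<Rightarrow>\<^sub>0 complex"

definition cpoly_eval :: "'i cpoly \<Rightarrow> ('i \<Rightarrow> complex) \<Rightarrow> complex" where
  "cpoly_eval p x =
     (\<Sum>m\<in>Poly_Mapping.keys p. Poly_Mapping.lookup p m * (\<Prod>i\<in>Poly_Mapping.keys m. x i ^ Poly_Mapping.lookup m i))"

definition cpoly_vars :: "'i cpoly \<Rightarrow> 'i set" where
  "cpoly_vars p = (\<Union>m\<in>Poly_Mapping.keys p. Poly_Mapping.keys m)"

definition homogeneous_poly :: "'i cpoly \<Rightarrow> bool" where
  "homogeneous_poly p \<longleftrightarrow> (\<exists>d. \<forall>m\<in>Poly_Mapping.keys p. (\<Sum>i\<in>Poly_Mapping.keys m. Poly_Mapping.lookup m i) = d)"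

definition zariski_closed :: "'i set \<Rightarrow> ('i \<Rightarrow> complex) set set \<Rightarrow> bool" where
  "zariski_closed I Z \<longleftrightarrow>
     (\<exists>F. (\<forall>p\<in>F. homogeneous_poly p \<and> cpoly_vars p \<subseteq> I) \<and>
          Z = {P \<in> proj_space I. \<forall>p\<in>F. \<forall>x\<in>P. cpoly_eval p x = 0})"

definition zariski_closure :: "'i set \<Rightarrow> ('i \<Rightarrow> complex) set set \<Rightarrow> ('i \<Rightarrow> complex) set set" where
  "zariski_closure I X = zariski_closed I hull X"

definition linear_space :: "'i set \<Rightarrow> nat \<Rightarrow> ('i \<Rightarrow> complex) set set \<Rightarrow> bool" where
  "linear_space I k \<Lambda> \<longleftrightarrow>
     (\<exists>U. cfun.subspace U \<and> U \<subseteq> coord_space I \<and> cfun.dim U = k + 1 \<and>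
          \<Lambda> = {P \<in> proj_space I. P \<subseteq> U})"

definition contains_indep_points ::
    "'i set \<Rightarrow> nat \<Rightarrow> ('i \<Rightarrow> complex) set set \<Rightarrow> bool" where
  "contains_indep_points I m Y \<longleftrightarrow>
     (\<exists>B. finite B \<and> card B = m \<and> cfun.independent B \<and> (\<forall>b\<in>B. b \<in> coord_space I \<and> proj_point I b \<in> Y))"

definition nondegenerate :: "'i set \<Rightarrow> ('i \<Rightarrow> complex) set set \<Rightarrow> bool" where
  "nondegenerate I X \<longleftrightarrow>
     (\<forall>U. cfun.subspace U \<and> U \<subseteq> coord_space I \<and> (\<forall>P\<in>X. P \<subseteq> U) \<longrightarrow> U = coord_space I)"

text \<open>
  \<open>card I \<le> k + 1\<close> says \<open>k \<ge> N\<close> for the dimension \<open>N = card I - 1\<close> of the ambient space; for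
  nondegenerate \<open>X\<close> the secant variety is then the whole space by convention.
\<close>

definition secant_variety :: "'i set \<Rightarrow> nat \<Rightarrow> ('i \<Rightarrow> complex) set set \<Rightarrow> ('i \<Rightarrow> complex) set set" where
  "secant_variety I k X =
     (if nondegenerate I X \<and> card I \<le> k + 1 then proj_space I
      else zariski_closure I (\<Union>{\<Lambda>. linear_space I k \<Lambda> \<and> contains_indep_points I (k + 1) (X \<inter> \<Lambda>)}))"

text \<open>
  \<open>sym_idx a b\<close> indexes the entries on and above the diagonal of a symmetric matrix whose rows
  and columns are numbered \<open>a, \<dots>, b\<close>. The matrices of \<open>Jordan_Normal_Form\<close> are numbered
  from 0, hence the shift by \<open>a\<close>.
\<close>

definition sym_idx :: "nat \<Rightarrow> nat \<Rightarrow> (nat \<times> nat) set" where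
  "sym_idx a b = {(i, j). a \<le> i \<and> i \<le> j \<and> j \<le> b}"

definition sym_mat :: "nat \<Rightarrow> nat \<Rightarrow> (nat \<times> nat \<Rightarrow> complex) \<Rightarrow> complex mat" where
  "sym_mat a b x = mat (b + 1 - a) (b + 1 - a) (\<lambda>(i, j). x (a + min i j, a + max i j))"

text \<open>\<open>veronese a b\<close> is the 2-Veronese variety of dimension \<open>b - a\<close> in these coordinates.\<close>

definition veronese :: "nat \<Rightarrow> nat \<Rightarrow> (nat \<times> nat \<Rightarrow> complex) set set" where
  "veronese a b =
     {P \<in> proj_space (sym_idx a b). \<forall>x\<in>P. vec_space.rank (b + 1 - a) (sym_mat a b x) = 1}"

definition cremona :: "nat \<Rightarrow> (nat \<times> nat \<Rightarrow> complex) \<Rightarrow> nat \<times> nat \<Rightarrow> complex" where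
  "cremona n x = (\<lambda>(i, j).
     if (i, j) \<notin> sym_idx 0 n then 0
     else if i = 0 then x (0, 0) * x (0, j)
     else x (0, 0) * x (i, j) - x (0, i) * x (0, j))"

text \<open>Affine form on the chart \<open>x\<^sub>0\<^sub>0 = 1\<close>.\<close>

lemma cremona_chart:
  assumes "x (0, 0) = 1"
  shows "cremona n x (0, 0) = 1"
    and "1 \<le> i \<Longrightarrow> i \<le> n \<Longrightarrow> cremona n x (0, i) = x (0, i)"
    and "1 \<le> i \<Longrightarrow> i \<le> j \<Longrightarrow> j \<le> n \<Longrightarrow> cremona n x (i, j) = x (i, j) - x (0, i) * x (0, j)"
  using assms by (auto simp: cremona_def sym_idx_def)

definition cremona_inv :: "nat \<Rightarrow> (nat \<times> nat \<Rightarrow> complex) \<Rightarrow> nat \<times> nat \<Rightarrow> complex" where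
  "cremona_inv n y = (\<lambda>(i, j).
     if (i, j) \<notin> sym_idx 0 n then 0
     else if i = 0 then y (0, 0) * y (0, j)
     else y (0, 0) * y (i, j) + y (0, i) * y (0, j))"

text \<open>Birationality: the two quadratic maps are mutually inverse up to a cubic factor.\<close>

lemma cremona_birational:
  assumes "x \<in> coord_space (sym_idx 0 n)"
  shows "cremona_inv n (cremona n x) = scale_fun (x (0, 0) ^ 3) x"
    and "cremona n (cremona_inv n x) = scale_fun (x (0, 0) ^ 3) x"
  using assms
  by (auto simp: cremona_def cremona_inv_def scale_fun_def coord_space_def sym_idx_def fun_eq_iff
      algebra_simps power3_eq_cube)

definition cremona_image ::
    "nat \<Rightarrow> (nat \<times> nat \<Rightarrow> complex) set set \<Rightarrow> (nat \<times> nat \<Rightarrow> complex) set set" where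
  "cremona_image n X = zariski_closure (sym_idx 0 n)
     {proj_point (sym_idx 0 n) (cremona n x) | P x. P \<in> X \<and> x \<in> P \<and> x (0, 0) \<noteq> 0}"

definition cone_vertex :: "nat \<Rightarrow> (nat \<times> nat \<Rightarrow> complex) set set" where
  "cone_vertex n = {P \<in> proj_space (sym_idx 0 n). \<forall>y\<in>P. \<forall>i j. 1 \<le> i \<and> i \<le> j \<and> j \<le> n \<longrightarrow> y (i, j) = 0}"

definition project_away :: "nat \<Rightarrow> (nat \<times> nat \<Rightarrow> complex) \<Rightarrow> nat \<times> nat \<Rightarrow> complex" where
  "project_away n y = (\<lambda>p. if p \<in> sym_idx 1 n then y p else 0)"

text \<open>
  If \<open>y\<close> represents a point of \<open>cone_vertex n\<close>, then \<open>project_away n y = 0\<close> and \<open>proj_point\<close> of it is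
  the empty set, which is not a point of any projective space.
\<close>

definition cone_over :: "nat \<Rightarrow> (nat \<times> nat \<Rightarrow> complex) set set \<Rightarrow> (nat \<times> nat \<Rightarrow> complex) set set" where
  "cone_over n W = {P \<in> proj_space (sym_idx 0 n).
     P \<in> cone_vertex n \<or> (\<forall>y\<in>P. proj_point (sym_idx 1 n) (project_away n y) \<in> W)}"

end

theory Submission
  imports Defs
begin

text \<open>
  \<open>Sec\<^sub>k\<^sub>-\<^sub>1\<close> of the 2-Veronese variety is exactly the locus of symmetric matrices of rank at most \<open>k\<close>:
  a symmetric complex matrix of rank at most \<open>k\<close> is a sum of \<open>k\<close> squares \<open>v v\<^sup>T\<close>, and since these span
  all symmetric matrices, the ones occurring can be completed to \<open>k\<close> independent ones. On
  \<open>x\<^sub>0\<^sub>0 \<noteq> 0\<close> the block \<open>(y\<^sub>i\<^sub>j)\<close> with \<open>i, j \<ge> 1\<close> of the image is \<open>x\<^sub>0\<^sub>0\<close> times the Schur complement of \<open>x\<^sub>0\<^sub>0\<close>, so its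
  rank drops by exactly one. Rank conditions are seen to be closed without minors, by recursion:
  a matrix \<open>A\<close> has rank at most \<open>k + 1\<close> iff every \<open>A\<^sub>p\<^sub>q A - A\<^sub>\<bullet>\<^sub>q A\<^sub>p\<^sub>\<bullet>\<close> has rank at most \<open>k\<close>.
\<close>

subsection \<open>Matrices of bounded rank\<close>

text \<open>Rank is encoded as a factorization through \<open>k\<close> columns. Arrays on all pairs
  of naturals avoid fixing a matrix size, and zero columns may pad the factorization, so
  \<open>k\<close> is an upper bound.\<close>

definition rank_le :: "nat \<Rightarrow> (nat \<Rightarrow> nat \<Rightarrow> complex) \<Rightarrow> bool" where
  "rank_le k A \<longleftrightarrow> (\<exists>u w. \<forall>i j. A i j = (\<Sum>l<k. u l i * w l j))"

lemma rank_leI: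
  assumes "finite L" and "card L \<le> k" and "\<And>i j. A i j = (\<Sum>l\<in>L. u l i * w l j)"
  shows "rank_le k A"
proof -
  obtain h where h: "bij_betw h {0..<card L} L"
    using ex_bij_betw_nat_finite[OF assms(1)] by blast
  define u' where "u' l = (if l < card L then u (h l) else (\<lambda>_. 0))" for l
  have "A i j = (\<Sum>l<k. u' l i * w (h l) j)" for i j
  proof -
    have "A i j = (\<Sum>l\<in>{0..<card L}. u (h l) i * w (h l) j)"
      unfolding assms(3) by (rule sum.reindex_bij_betw[OF h, symmetric])
    also have "\<dots> = (\<Sum>l\<in>{0..<card L}. u' l i * w (h l) j)"
      by (auto simp: u'_def)
    also have "\<dots> = (\<Sum>l<k. u' l i * w (h l) j)"
      using assms(2) by (intro sum.mono_neutral_left) (auto simp: u'_def)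
    finally show ?thesis .
  qed
  then show ?thesis
    unfolding rank_le_def by (intro exI[of _ u'] exI[of _ "\<lambda>l. w (h l)"]) blast
qed

lemma rank_leE:
  assumes "rank_le k A"
  obtains u w where "\<And>i j. A i j = (\<Sum>l<k. u l i * w l j)"
  using assms unfolding rank_le_def by metis

lemma rank_le_0_iff: "rank_le 0 A \<longleftrightarrow> (\<forall>i j. A i j = 0)"
  by (auto simp: rank_le_def)

lemma rank_le_zero: "rank_le k (\<lambda>i j. 0)"
  by (rule rank_leI[of "{}"]) auto

lemma rank_le_outer: "1 \<le> k \<Longrightarrow> rank_le k (\<lambda>i j. u i * w j)"
  by (rule rank_leI[of "{0::nat}" _ _ "\<lambda>_. u" "\<lambda>_. w"]) auto

lemma rank_le_1D: "rank_le 1 A \<Longrightarrow> \<exists>u w. \<forall>i j. A i j = u i * w j"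
  unfolding rank_le_def by (simp add: lessThan_Suc) metis

lemma rank_le_scale: "rank_le k A \<Longrightarrow> rank_le k (\<lambda>i j. c * A i j)"
proof (erule rank_leE)
  fix u w assume "\<And>i j. A i j = (\<Sum>l<k. u l i * w l j)"
  then show ?thesis
    by (intro rank_leI[of "{..<k}" _ _ "\<lambda>l i. c * u l i" w])
       (auto simp: sum_distrib_left mult.assoc)
qed

lemma rank_le_add_outer:
  assumes "rank_le k A"
  shows "rank_le (Suc k) (\<lambda>i j. A i j + u i * w j)"
proof -
  obtain u0 w0 where "\<And>i j. A i j = (\<Sum>l<k. u0 l i * w0 l j)"
    using assms by (rule rank_leE) blast
  then show ?thesis
    by (intro rank_leI[of "{..<Suc k}" _ _ "u0(k := u)" "w0(k := w)"]) auto
qed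

text \<open>Wedderburn's rank reduction, cleared of denominators: with \<open>A = U W\<^sup>T\<close>, the new matrix
  is \<open>U (s I - a b\<^sup>T) W\<^sup>T\<close>, and the middle factor kills \<open>a\<close>.\<close>

lemma rank_le_reduce:
  fixes u w :: "nat \<Rightarrow> nat \<Rightarrow> complex"
  assumes A: "\<And>i j. A i j = (\<Sum>l<Suc k. u l i * w l j)"
    and s: "s = (\<Sum>l<Suc k. a l * b l)" "s \<noteq> 0"
  shows "rank_le k (\<lambda>i j. s * A i j - (\<Sum>l<Suc k. u l i * a l) * (\<Sum>l<Suc k. b l * w l j))"
proof -
  define L where "L = {..<Suc k}"
  obtain p where p: "p \<in> L" "a p \<noteq> 0"
    using s by (force simp: L_def intro!: sum.neutral)
  define c where "c i = (\<Sum>l\<in>L. u l i * a l)" for i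
  \<comment> \<open>With \<open>A = U W^T\<close>, \<open>c\<close> is \<open>U a\<close> and
    \<open>m q\<close> is column \<open>q\<close> of \<open>U (s I - a b^T)\<close>.\<close>
  define m where "m q i = s * u q i - c i * b q" for q i
  have m0: "(\<Sum>q\<in>L. m q i * a q) = 0" for i
  proof -
    have "(\<Sum>q\<in>L. m q i * a q) = s * (\<Sum>q\<in>L. u q i * a q) - c i * (\<Sum>q\<in>L. a q * b q)"
      by (simp add: m_def algebra_simps sum_subtractf sum_distrib_left)
    then show ?thesis
      using s(1) by (simp add: c_def L_def)
  qed
  have "s * A i j - c i * (\<Sum>l\<in>L. b l * w l j)
      = (\<Sum>q\<in>L - {p}. m q i * (w q j - a q / a p * w p j))" for i j
  proof -
    have "s * A i j - c i * (\<Sum>l\<in>L. b l * w l j) = (\<Sum>q\<in>L. m q i * w q j)"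
      by (simp only: A L_def[symmetric])
         (simp add: m_def algebra_simps sum_subtractf sum_distrib_left)
    \<comment> \<open>A multiple of the vanishing sum \<open>m0\<close> is subtracted, chosen so
      that the summand at \<open>q = p\<close> cancels and \<open>k\<close> summands remain.\<close>
    also have "\<dots> = (\<Sum>q\<in>L. m q i * w q j) - (\<Sum>q\<in>L. m q i * a q) * (w p j / a p)"
      by (simp add: m0)
    also have "\<dots> = (\<Sum>q\<in>L. m q i * (w q j - a q / a p * w p j))"
      by (simp add: algebra_simps sum_subtractf sum_distrib_left sum_distrib_right sum_divide_distrib)
    also have "\<dots> = (\<Sum>q\<in>L - {p}. m q i * (w q j - a q / a p * w p j))"
      using p by (subst sum.remove[of _ p]) (auto simp: L_def)
    finally show ?thesis .
  qed
  moreover have "finite (L - {p})" "card (L - {p}) \<le> k"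
    using p by (auto simp: L_def)
  ultimately show ?thesis
    unfolding c_def L_def by (intro rank_leI[of "L - {p}"]) (auto simp: L_def)
qed

text \<open>The entries are the 2x2 minors on rows \<open>p, i\<close> and columns
  \<open>q, j\<close>. For a nonzero pivot \<open>A p q\<close> this is the pivot times the Schur
  complement, bordered by a zero row \<open>p\<close> and a zero column \<open>q\<close>.\<close>

definition schur :: "nat \<Rightarrow> nat \<Rightarrow> (nat \<Rightarrow> nat \<Rightarrow> complex) \<Rightarrow> nat \<Rightarrow> nat \<Rightarrow> complex" where
  "schur p q A = (\<lambda>i j. A p q * A i j - A i q * A p j)"

text \<open>Wedderburn reduction with \<open>a l = w l q\<close> and \<open>b l = u l p\<close>:
  then \<open>U a\<close> is column \<open>q\<close> of \<open>A\<close>, \<open>b W^T\<close> is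
  row \<open>p\<close>, and \<open>s\<close> is the pivot.\<close>

lemma rank_le_schur:
  assumes "rank_le (Suc k) A" and "A p q \<noteq> 0"
  shows "rank_le k (schur p q A)"
proof -
  obtain u w where A: "\<And>i j. A i j = (\<Sum>l<Suc k. u l i * w l j)"
    using assms(1) by (rule rank_leE) blast
  have "A p q = (\<Sum>l<Suc k. w l q * u l p)"
    unfolding A by (simp add: mult.commute)
  from rank_le_reduce[OF A this assms(2)] show ?thesis
    unfolding schur_def A[symmetric] .
qed

lemma rank_le_of_schur:
  assumes "rank_le k (schur p q A)" and "A p q \<noteq> 0"
  shows "rank_le (Suc k) A"
proof -
  have "A = (\<lambda>i j. inverse (A p q) * schur p q A i j + (inverse (A p q) * A i q) * A p j)"
    using assms(2) by (auto simp: schur_def fun_eq_iff field_simps)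
  then show ?thesis
    by (rule ssubst) (intro rank_le_add_outer rank_le_scale assms(1))
qed

text \<open>For a nonzero pivot this is rank reduction and its reversal. At a zero pivot
  \<open>schur p q A\<close> is an outer product, and only the zero array has no nonzero pivot.
  Quantifying over all positions makes the condition free of case distinctions, hence
  polynomial.\<close>

lemma rank_le_Suc_iff: "rank_le (Suc k) A \<longleftrightarrow> (\<forall>p q. rank_le k (schur p q A))"
proof (intro iffI allI)
  fix p q assume A: "rank_le (Suc k) A"
  show "rank_le k (schur p q A)"
  proof (cases "A p q = 0")
    case False
    then show ?thesis using A by (rule rank_le_schur[rotated])
  next
    case True
    show ?thesis
    \<comment> \<open>An outer product has rank at most \<open>k\<close> only once \<open>k\<close>
      is positive; for \<open>k = 0\<close> all 2x2 minors of an array of rank at most 1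
      vanish.\<close>
    proof (cases k)
      case 0
      then obtain u w where "\<And>i j. A i j = u i * w j"
        using A by (auto elim!: rank_leE)
      then show ?thesis
        by (auto simp: 0 rank_le_0_iff schur_def)
    next
      case (Suc m)
      have "schur p q A = (\<lambda>i j. (- A i q) * A p j)"
        by (simp add: schur_def True)
      then show ?thesis
        by (simp only:) (rule rank_le_outer, simp add: Suc)
    qed
  qed
next
  assume *: "\<forall>p q. rank_le k (schur p q A)"
  show "rank_le (Suc k) A"
  proof (cases "\<forall>p q. A p q = 0")
    case True
    then have "A = (\<lambda>i j. 0)" by (simp add: fun_eq_iff)
    then show ?thesis by (simp add: rank_le_zero)
  next
    case False
    then show ?thesis using * rank_le_of_schur by blast
  qed
qed

text \<open>Completing the square: splitting off the square of \<open>A x\<close>, for a vector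
  \<open>x\<close> at which the quadratic form is nonzero, lowers the rank bound by one and keeps
  the array symmetric. Complex square roots absorb the coefficients.\<close>

lemma symmetric_rank_decomposition:
  assumes "rank_le k A" and "\<And>i j. A i j = A j i"
  shows "\<exists>v. \<forall>i j. A i j = (\<Sum>l<k. v l i * v l j)"
  using assms
proof (induction k arbitrary: A)
  case 0
  then show ?case by (simp add: rank_le_0_iff)
next
  case (Suc k)
  show ?case
  proof (cases "\<forall>i j. A i j = 0")
    case True
    then show ?thesis by (intro exI[of _ "\<lambda>l i. 0"]) simp
  next
    case False
    then obtain p q where pq: "A p q \<noteq> 0" by blast
    \<comment> \<open>The quadratic form is nonzero at one of \<open>e\<^sub>p\<close>, \<open>e\<^sub>p + e\<^sub>q\<close>, \<open>e\<^sub>p - e\<^sub>q\<close>.\<close>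
    define S where "S c = A p p + c * A p q + c * A q p + c * c * A q q" for c
    have "S 0 \<noteq> 0 \<or> S 1 \<noteq> 0 \<or> S (-1) \<noteq> 0"
    proof (rule ccontr)
      assume "\<not> ?thesis"
      then have "S 1 - S (-1) = 0" by simp
      \<comment> \<open>Polarization: \<open>S 1 - S (-1) = 2 * (A p q + A q p)\<close>, which is
        \<open>4 * A p q\<close> by symmetry.\<close>
      then have "4 * A p q = 0"
        using Suc.prems(2)[of q p] by (simp add: S_def)
      then show False using pq by simp
    qed
    then obtain c where c: "S c \<noteq> 0" by blast
    define s where "s = S c"
    define col where "col i = A i p + c * A i q" for i
    obtain u w where A: "\<And>i j. A i j = (\<Sum>l<Suc k. u l i * w l j)"
      using Suc.prems(1) by (rule rank_leE) blast
    \<comment> \<open>For \<open>x = e_p + c e_q\<close> the weights are \<open>a = W^T x\<close>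
      and \<open>b = U^T x\<close>, so \<open>s = x^T A x\<close> and
      \<open>col = A x\<close>.\<close>
    have 1: "s = (\<Sum>l<Suc k. (w l p + c * w l q) * (u l p + c * u l q))"
      unfolding s_def S_def A by (simp add: algebra_simps sum.distrib sum_distrib_left)
    have 2: "(\<Sum>l<Suc k. u l i * (w l p + c * w l q)) = col i" for i
      unfolding col_def A by (simp add: algebra_simps sum.distrib sum_distrib_left)
    have "(\<Sum>l<Suc k. (u l p + c * u l q) * w l j) = A p j + c * A q j" for j
      unfolding A by (simp add: algebra_simps sum.distrib sum_distrib_left)
    \<comment> \<open>By symmetry the row \<open>x^T A\<close> equals the column \<open>A x\<close>,
      so a square is being subtracted.\<close>
    then have 3: "(\<Sum>l<Suc k. (u l p + c * u l q) * w l j) = col j" for j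
      unfolding col_def using Suc.prems(2)[of j] by simp
    have "rank_le k (\<lambda>i j. s * A i j - col i * col j)"
      using rank_le_reduce[OF A 1] c unfolding 2 3 by (simp add: s_def)
    then have "rank_le k (\<lambda>i j. inverse s * (s * A i j - col i * col j))"
      by (rule rank_le_scale)
    from Suc.IH[OF this] obtain v
      where v: "\<And>i j. inverse s * (s * A i j - col i * col j) = (\<Sum>l<k. v l i * v l j)"
      using Suc.prems(2) by (auto simp: mult.commute)
    define v' where "v' = v(k := \<lambda>i. col i / csqrt s)"
    have "A i j = (\<Sum>l<Suc k. v' l i * v' l j)" for i j
    proof -
      have "(\<Sum>l<Suc k. v' l i * v' l j) = (\<Sum>l<k. v l i * v l j) + col i * col j / (csqrt s * csqrt s)"
        by (simp add: v'_def)
      also have "csqrt s * csqrt s = s"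
        by (metis power2_csqrt power2_eq_square)
      also have "(\<Sum>l<k. v l i * v l j) + col i * col j / s = A i j"
        unfolding v[symmetric] using c by (simp add: s_def field_simps)
      finally show ?thesis by simp
    qed
    then show ?thesis by blast
  qed
qed

subsection \<open>Projective points and Zariski closed sets\<close>

lemma in_proj_point_iff:
  "y \<in> proj_point I x \<longleftrightarrow>
     x \<in> coord_space I \<and> x \<noteq> 0 \<and> (\<exists>c. c \<noteq> 0 \<and> y = scale_fun c x)"
  by (auto simp: proj_point_def proj_rel_def coord_space_def scale_fun_def fun_eq_iff)

lemma equiv_proj_rel: "equiv (coord_space I - {0}) (proj_rel I)"
proof (rule equivI)
  show "refl_on (coord_space I - {0}) (proj_rel I)"
    by (auto simp: refl_on_def proj_rel_def intro!: exI[of _ 1])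
  show "sym (proj_rel I)"
  proof (rule symI)
    fix x y assume "(x, y) \<in> proj_rel I"
    then obtain c where "c \<noteq> 0" "y = scale_fun c x" "x \<in> coord_space I - {0}"
        "y \<in> coord_space I - {0}"
      by (auto simp: proj_rel_def)
    then show "(y, x) \<in> proj_rel I"
      by (auto simp: proj_rel_def intro!: exI[of _ "inverse c"])
  qed
  show "trans (proj_rel I)"
  proof (rule transI)
    fix x y z assume "(x, y) \<in> proj_rel I" "(y, z) \<in> proj_rel I"
    then obtain c d where "c \<noteq> 0" "y = scale_fun c x" "d \<noteq> 0" "z = scale_fun d y"
      "x \<in> coord_space I - {0}" "z \<in> coord_space I - {0}"
      by (auto simp: proj_rel_def)
    then show "(x, z) \<in> proj_rel I"
      by (auto simp: proj_rel_def intro!: exI[of _ "d * c"])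
  qed
qed (auto simp: proj_rel_def)

lemma proj_point_in_proj_space:
  assumes "x \<in> coord_space I" "x \<noteq> 0"
  shows "proj_point I x \<in> proj_space I" "x \<in> proj_point I x"
proof -
  show "proj_point I x \<in> proj_space I"
    using assms unfolding proj_space_def proj_point_def by (intro quotientI) auto
  show "x \<in> proj_point I x"
    using assms by (auto simp: in_proj_point_iff intro!: exI[of _ 1])
qed

lemma proj_spaceD:
  assumes "P \<in> proj_space I" "x \<in> P"
  shows "x \<in> coord_space I" "x \<noteq> 0" "P = proj_point I x"
proof -
  have "P \<subseteq> coord_space I - {0}"
    using assms(1) equiv_proj_rel[of I] unfolding proj_space_def
    by (rule in_quotient_imp_subset[rotated])
  then show "x \<in> coord_space I" "x \<noteq> 0"
    using assms(2) by auto
  obtain z where z: "P = proj_rel I `` {z}" "z \<in> coord_space I - {0}"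
    using assms(1) unfolding proj_space_def by (auto elim: quotientE)
  then show "P = proj_point I x"
    using assms(2) equiv_class_eq[OF equiv_proj_rel, of z x I] by (auto simp: proj_point_def)
qed

lemma proj_spaceE:
  assumes "P \<in> proj_space I"
  obtains x where "x \<in> coord_space I" "x \<noteq> 0" "P = proj_point I x" "x \<in> P"
proof -
  have "P \<noteq> {}"
    using assms equiv_proj_rel[of I] unfolding proj_space_def by (rule in_quotient_imp_non_empty[rotated])
  then show thesis
    using that proj_spaceD[OF assms] by blast
qed

lemma proj_point_scale_fun:
  assumes "x \<in> coord_space I" "x \<noteq> 0" "c \<noteq> 0"
  shows "proj_point I (scale_fun c x) = proj_point I x"
proof -
  have "scale_fun c x \<in> proj_point I x"
    using assms by (auto simp: in_proj_point_iff)
  then show ?thesis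
    using proj_spaceD(3)[OF proj_point_in_proj_space(1)[OF assms(1,2)]] by simp
qed

section \<open>Evaluation and degree of polynomials\<close>

definition monom_eval :: "('i \<Rightarrow>\<^sub>0 nat) \<Rightarrow> ('i \<Rightarrow> complex) \<Rightarrow> complex" where
  "monom_eval m x = (\<Prod>i\<in>Poly_Mapping.keys m. x i ^ Poly_Mapping.lookup m i)"

definition monom_deg :: "('i \<Rightarrow>\<^sub>0 nat) \<Rightarrow> nat" where
  "monom_deg m = (\<Sum>i\<in>Poly_Mapping.keys m. Poly_Mapping.lookup m i)"

lemma monom_eval_superset:
  "finite K \<Longrightarrow> Poly_Mapping.keys m \<subseteq> K \<Longrightarrow> monom_eval m x = (\<Prod>i\<in>K. x i ^ Poly_Mapping.lookup m i)"
  unfolding monom_eval_def by (rule prod.mono_neutral_left) (auto simp: in_keys_iff)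

lemma monom_deg_superset:
  "finite K \<Longrightarrow> Poly_Mapping.keys m \<subseteq> K \<Longrightarrow> monom_deg m = (\<Sum>i\<in>K. Poly_Mapping.lookup m i)"
  unfolding monom_deg_def by (rule sum.mono_neutral_left) (auto simp: in_keys_iff)

lemma monom_eval_add: "monom_eval (m + m') x = monom_eval m x * monom_eval m' x"
proof -
  define K where "K = Poly_Mapping.keys m \<union> Poly_Mapping.keys m'"
  have "finite K" "Poly_Mapping.keys m \<subseteq> K" "Poly_Mapping.keys m' \<subseteq> K" "Poly_Mapping.keys (m + m') \<subseteq> K"
    using Poly_Mapping.keys_add[of m m'] by (auto simp: K_def)
  then show ?thesis
    by (simp add: monom_eval_superset lookup_add power_add prod.distrib)
qed

lemma monom_deg_add: "monom_deg (m + m') = monom_deg m + monom_deg m'"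
proof -
  define K where "K = Poly_Mapping.keys m \<union> Poly_Mapping.keys m'"
  have "finite K" "Poly_Mapping.keys m \<subseteq> K" "Poly_Mapping.keys m' \<subseteq> K" "Poly_Mapping.keys (m + m') \<subseteq> K"
    using Poly_Mapping.keys_add[of m m'] by (auto simp: K_def)
  then show ?thesis
    by (simp add: monom_deg_superset lookup_add sum.distrib)
qed

lemma cpoly_eval_superset:
  assumes "finite K" "Poly_Mapping.keys p \<subseteq> K"
  shows "cpoly_eval p x = (\<Sum>m\<in>K. Poly_Mapping.lookup p m * monom_eval m x)"
  unfolding cpoly_eval_def monom_eval_def[symmetric]
  using assms by (intro sum.mono_neutral_left) (auto simp: in_keys_iff)

lemma cpoly_eval_add: "cpoly_eval (p + q) x = cpoly_eval p x + cpoly_eval q x"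
proof -
  define K where "K = Poly_Mapping.keys p \<union> Poly_Mapping.keys q"
  have "finite K" "Poly_Mapping.keys p \<subseteq> K" "Poly_Mapping.keys q \<subseteq> K" "Poly_Mapping.keys (p + q) \<subseteq> K"
    using Poly_Mapping.keys_add[of p q] by (auto simp: K_def)
  then show ?thesis
    by (simp add: cpoly_eval_superset lookup_add sum.distrib distrib_right)
qed

lemma cpoly_eval_single: "cpoly_eval (Poly_Mapping.single m c) x = c * monom_eval m x"
  by (simp add: cpoly_eval_superset[of "{m}"])

text \<open>Serves to pass vanishing at all nonzero parameters of a line to the parameter 0.\<close>

lemma isCont_cpoly_eval_line:
  "isCont (\<lambda>t. cpoly_eval p (\<lambda>i. y i + t * e i)) t"
  unfolding cpoly_eval_def by (intro continuous_intros)

section \<open>Homogeneous forms as functions\<close>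

text \<open>A term is a coefficient with a list of variables, repetition giving the exponent.
  Degrees are then lengths and products are concatenations.\<close>

definition monom_list_eval :: "(complex \<times> 'i list) list \<Rightarrow> ('i \<Rightarrow> complex) \<Rightarrow> complex" where
  "monom_list_eval ts x = (\<Sum>(c, l)\<leftarrow>ts. c * prod_list (map x l))"

text \<open>Agreement with a form is required on \<open>coord_space I\<close> only, so coordinates outside \<open>I\<close>
  count as the zero form.\<close>

definition is_form :: "'i set \<Rightarrow> nat \<Rightarrow> (('i \<Rightarrow> complex) \<Rightarrow> complex) \<Rightarrow> bool" where
  "is_form I d f \<longleftrightarrow> (\<exists>ts. (\<forall>(c, l)\<in>set ts. length l = d \<and> set l \<subseteq> I) \<and>
     (\<forall>x\<in>coord_space I. f x = monom_list_eval ts x))"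

lemma is_form_zero: "is_form I d (\<lambda>x. 0)"
  unfolding is_form_def by (rule exI[of _ "[]"]) (simp add: monom_list_eval_def)

lemma is_form_coord: "is_form I 1 (\<lambda>x. x i)"
proof (cases "i \<in> I")
  case True
  then show ?thesis
    unfolding is_form_def by (intro exI[of _ "[(1, [i])]"]) (simp add: monom_list_eval_def)
next
  case False
  then show ?thesis
    unfolding is_form_def by (intro exI[of _ "[]"]) (simp add: monom_list_eval_def coord_space_def)
qed

lemma is_form_add:
  assumes "is_form I d f" "is_form I d g"
  shows "is_form I d (\<lambda>x. f x + g x)"
proof -
  obtain ts us where
    "\<forall>(c, l)\<in>set ts. length l = d \<and> set l \<subseteq> I" "\<forall>x\<in>coord_space I. f x = monom_list_eval ts x"
    "\<forall>(c, l)\<in>set us. length l = d \<and> set l \<subseteq> I" "\<forall>x\<in>coord_space I. g x = monom_list_eval us x"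
    using assms unfolding is_form_def by auto
  then show ?thesis
    unfolding is_form_def by (intro exI[of _ "ts @ us"]) (auto simp: monom_list_eval_def)
qed

lemma monom_list_eval_mult_term:
  "monom_list_eval (map (\<lambda>(c', l'). (c * c', l @ l')) us) x
    = c * prod_list (map x l) * monom_list_eval us x"
  by (induction us) (auto simp: monom_list_eval_def algebra_simps)

lemma monom_list_eval_mult:
  "monom_list_eval (concat (map (\<lambda>(c, l). map (\<lambda>(c', l'). (c * c', l @ l')) us) ts)) x
    = monom_list_eval ts x * monom_list_eval us x"
proof (induction ts)
  case Nil
  then show ?case by (simp add: monom_list_eval_def)
next
  case (Cons t ts)
  have append: "monom_list_eval (a @ b) x = monom_list_eval a x + monom_list_eval b x" for a b
    by (simp add: monom_list_eval_def)
  obtain c l where t: "t = (c, l)" by fastforce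
  have "monom_list_eval (t # ts) x = c * prod_list (map x l) + monom_list_eval ts x"
    by (simp add: monom_list_eval_def t)
  with Cons show ?case
    by (simp add: t append monom_list_eval_mult_term distrib_right)
qed

lemma is_form_mult:
  assumes "is_form I d f" "is_form I e g"
  shows "is_form I (d + e) (\<lambda>x. f x * g x)"
proof -
  obtain ts us where
    "\<forall>(c, l)\<in>set ts. length l = d \<and> set l \<subseteq> I" "\<forall>x\<in>coord_space I. f x = monom_list_eval ts x"
    "\<forall>(c, l)\<in>set us. length l = e \<and> set l \<subseteq> I" "\<forall>x\<in>coord_space I. g x = monom_list_eval us x"
    using assms unfolding is_form_def by auto
  then show ?thesis
    unfolding is_form_def
    by (intro exI[of _ "concat (map (\<lambda>(c, l). map (\<lambda>(c', l'). (c * c', l @ l')) us) ts)"])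
       (fastforce simp: monom_list_eval_mult)
qed

lemma is_form_const: "is_form I 0 (\<lambda>x. c)"
  unfolding is_form_def by (intro exI[of _ "[(c, [])]"]) (simp add: monom_list_eval_def)

lemma is_form_diff:
  assumes "is_form I d f" "is_form I d g"
  shows "is_form I d (\<lambda>x. f x - g x)"
proof -
  have "is_form I d (\<lambda>x. f x + (- 1) * g x)"
    using is_form_mult[OF is_form_const assms(2), of "- 1"] by (intro is_form_add assms(1)) simp
  then show ?thesis by simp
qed

text \<open>Each term contributes one monomial of degree \<open>d\<close>; cancellation between
  terms can only shrink the set of monomials, so homogeneity survives.\<close>

lemma monom_list_to_cpoly:
  assumes "\<forall>(c, l)\<in>set ts. length l = d \<and> set l \<subseteq> I"
  shows "\<exists>p. (\<forall>m\<in>Poly_Mapping.keys p. monom_deg m = d) \<and> cpoly_vars p \<subseteq> I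
    \<and> (\<forall>x. cpoly_eval p x = monom_list_eval ts x)"
  using assms
proof (induction ts)
  case Nil
  show ?case
    by (rule exI[of _ 0]) (simp add: cpoly_vars_def monom_list_eval_def cpoly_eval_def)
next
  case (Cons t ts)
  obtain c l where t: "t = (c, l)" by fastforce
  obtain p where p: "\<forall>m\<in>Poly_Mapping.keys p. monom_deg m = d" "cpoly_vars p \<subseteq> I"
    "\<forall>x. cpoly_eval p x = monom_list_eval ts x"
    using Cons by auto
  define m where "m = (\<Sum>i\<leftarrow>l. Poly_Mapping.single i (1::nat))"
  have m: "monom_deg m = length l" "monom_eval m x = prod_list (map x l)"
      "Poly_Mapping.keys m \<subseteq> set l" for x
  proof -
    show "monom_deg m = length l"
      unfolding m_def by (induction l) (auto simp: monom_deg_add, simp_all add: monom_deg_def)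
    show "monom_eval m x = prod_list (map x l)"
      unfolding m_def by (induction l) (auto simp: monom_eval_add, simp_all add: monom_eval_def)
    show "Poly_Mapping.keys m \<subseteq> set l"
      unfolding m_def
    proof (induction l)
      case (Cons i l)
      then show ?case
        using Poly_Mapping.keys_add[of "Poly_Mapping.single i 1" "\<Sum>i\<leftarrow>l. Poly_Mapping.single i (1::nat)"]
        by auto
    qed simp
  qed
  define q where "q = Poly_Mapping.single m c + p"
  have "Poly_Mapping.keys q \<subseteq> {m} \<union> Poly_Mapping.keys p"
    unfolding q_def using Poly_Mapping.keys_add[of "Poly_Mapping.single m c" p]
    by (auto split: if_splits)
  moreover have "length l = d" "set l \<subseteq> I"
    using Cons.prems by (auto simp: t)
  ultimately have "\<forall>m\<in>Poly_Mapping.keys q. monom_deg m = d" "cpoly_vars q \<subseteq> I"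
    using p m(1,3) by (auto simp: cpoly_vars_def) blast+
  moreover have "cpoly_eval q x = monom_list_eval (t # ts) x" for x
    using p(3) by (simp add: q_def cpoly_eval_add cpoly_eval_single m(2) t monom_list_eval_def)
  ultimately show ?case by blast
qed

lemma is_form_imp_cpoly:
  assumes "is_form I d f"
  obtains p where "homogeneous_poly p" "cpoly_vars p \<subseteq> I" "\<And>x. x \<in> coord_space I \<Longrightarrow> cpoly_eval p x = f x"
proof -
  obtain ts where ts: "\<forall>(c, l)\<in>set ts. length l = d \<and> set l \<subseteq> I"
      "\<forall>x\<in>coord_space I. f x = monom_list_eval ts x"
    using assms unfolding is_form_def by blast
  from monom_list_to_cpoly[OF ts(1)] show ?thesis
    using that ts(2) unfolding homogeneous_poly_def monom_deg_def by metis
qed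

text \<open>Closedness can be shown with functions that are forms instead of formal polynomials. The
  family may be infinite and its degrees may vary.\<close>

lemma zariski_closed_zeros:
  assumes "\<And>f. f \<in> F \<Longrightarrow> \<exists>d. is_form I d f"
  shows "zariski_closed I {P \<in> proj_space I. \<forall>x\<in>P. \<forall>f\<in>F. f x = 0}"
proof -
  define G where "G = {p. homogeneous_poly p \<and> cpoly_vars p \<subseteq> I \<and>
    (\<exists>f\<in>F. \<forall>x\<in>coord_space I. cpoly_eval p x = f x)}"
  have eq: "(\<forall>x\<in>P. \<forall>f\<in>F. f x = 0) \<longleftrightarrow> (\<forall>p\<in>G. \<forall>x\<in>P. cpoly_eval p x = 0)" if "P \<in> proj_space I" for P
  proof -
    have P: "x \<in> coord_space I" if "x \<in> P" for x
      using proj_spaceD(1)[OF \<open>P \<in> proj_space I\<close> that] .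
    have G: "\<exists>p\<in>G. \<forall>x\<in>coord_space I. cpoly_eval p x = f x" if f: "f \<in> F" for f
    proof -
      obtain d where "is_form I d f"
        using assms[OF f] by blast
      then obtain p where "homogeneous_poly p" "cpoly_vars p \<subseteq> I"
          "\<And>x. x \<in> coord_space I \<Longrightarrow> cpoly_eval p x = f x"
        by (rule is_form_imp_cpoly) blast
      then show ?thesis
        using f unfolding G_def by blast
    qed
    show ?thesis
    proof (intro iffI ballI)
      fix p x assume "\<forall>x\<in>P. \<forall>f\<in>F. f x = 0" "p \<in> G" "x \<in> P"
      then show "cpoly_eval p x = 0"
        using P unfolding G_def by auto
    next
      fix x f assume *: "\<forall>p\<in>G. \<forall>x\<in>P. cpoly_eval p x = 0" "x \<in> P" "f \<in> F"
      obtain p where "p \<in> G" "\<forall>x\<in>coord_space I. cpoly_eval p x = f x"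
        using G[OF *(3)] by blast
      then show "f x = 0"
        using * P by force
    qed
  qed
  show ?thesis
    unfolding zariski_closed_def
  proof (intro exI conjI)
    show "\<forall>p\<in>G. homogeneous_poly p \<and> cpoly_vars p \<subseteq> I"
      by (simp add: G_def)
    show "{P \<in> proj_space I. \<forall>x\<in>P. \<forall>f\<in>F. f x = 0} = {P \<in> proj_space I. \<forall>p\<in>G. \<forall>x\<in>P. cpoly_eval p x = 0}"
      using eq by (intro Collect_cong conj_cong refl)
  qed
qed

section \<open>Closedness of rank conditions\<close>

lemma is_form_schur:
  assumes "\<And>i j. is_form I d (\<lambda>x. B x i j)"
  shows "is_form I (d + d) (\<lambda>x. schur p q (B x) i j)"
  unfolding schur_def by (intro is_form_diff is_form_mult assms)

text \<open>Unfolding \<open>rank_le_Suc_iff\<close> replaces \<open>B\<close> by all its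
  reductions, doubling the degree of the entries, until the bound is 0 and the entries themselves
  are the equations.\<close>

lemma rank_le_as_zeros:
  assumes "\<And>i j. is_form I d (\<lambda>x. B x i j)"
  shows "\<exists>F. (\<forall>f\<in>F. \<exists>d. is_form I d f) \<and> (\<forall>x. rank_le k (B x) \<longleftrightarrow> (\<forall>f\<in>F. f x = 0))"
  using assms
proof (induction k arbitrary: B d)
  case 0
  then show ?case
    by (intro exI[of _ "\<Union>i j. {\<lambda>x. B x i j}"]) (auto simp: rank_le_0_iff)
next
  case (Suc k)
  have "\<exists>F. (\<forall>f\<in>F. \<exists>d. is_form I d f) \<and>
      (\<forall>x. rank_le k (schur p q (B x)) \<longleftrightarrow> (\<forall>f\<in>F. f x = 0))" for p q
    using Suc.IH[OF is_form_schur[OF Suc.prems]] .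
  then obtain F where F: "\<And>p q. \<forall>f\<in>F p q. \<exists>d. is_form I d f"
      "\<And>p q x. rank_le k (schur p q (B x)) \<longleftrightarrow> (\<forall>f\<in>F p q. f x = 0)"
    by metis
  then show ?case
    by (intro exI[of _ "\<Union>p q. F p q"]) (auto simp: rank_le_Suc_iff)
qed

lemma zariski_closed_rank_le:
  assumes "\<And>i j. is_form I d (\<lambda>x. B x i j)"
  shows "zariski_closed I {P \<in> proj_space I. \<forall>x\<in>P. rank_le k (B x)}"
proof -
  obtain F where F: "\<forall>f\<in>F. \<exists>d. is_form I d f" "\<forall>x. rank_le k (B x) \<longleftrightarrow> (\<forall>f\<in>F. f x = 0)"
    using rank_le_as_zeros[of I d B k, OF assms] by (elim exE conjE) (rule that)
  have "zariski_closed I {P \<in> proj_space I. \<forall>x\<in>P. \<forall>f\<in>F. f x = 0}"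
    using F(1) by (intro zariski_closed_zeros) blast
  then show ?thesis
    by (simp only: F(2))
qed

lemma zariski_closure_eqI:
  assumes "X \<subseteq> Z" "zariski_closed I Z" "\<And>T. zariski_closed I T \<Longrightarrow> X \<subseteq> T \<Longrightarrow> Z \<subseteq> T"
  shows "zariski_closure I X = Z"
  unfolding zariski_closure_def using assms by (intro hull_unique)

lemma zariski_closure_closed: "zariski_closed I X \<Longrightarrow> zariski_closure I X = X"
  by (rule zariski_closure_eqI) auto

subsection \<open>Rank loci of symmetric matrices\<close>

text \<open>The upper triangular coordinates are extended to a symmetric array on all pairs of
  naturals. For points of \<open>coord_space (sym_idx a b)\<close> it vanishes outside the block
  \<open>a..b\<close>, so its rank is that of the block.\<close>

definition sym_entries :: "(nat \<times> nat \<Rightarrow> complex) \<Rightarrow> nat \<Rightarrow> nat \<Rightarrow> complex" where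
  "sym_entries x = (\<lambda>i j. x (min i j, max i j))"

lemma sym_entries_sym: "sym_entries x i j = sym_entries x j i"
  by (simp add: sym_entries_def min.commute max.commute)

lemma sym_entries_nz_imp_range:
  assumes "x \<in> coord_space (sym_idx a b)" "sym_entries x i j \<noteq> 0"
  shows "i \<in> {a..b}" "j \<in> {a..b}"
proof -
  have "(min i j, max i j) \<in> sym_idx a b"
    using assms by (auto simp: sym_entries_def coord_space_def)
  then show "i \<in> {a..b}" "j \<in> {a..b}"
    by (auto simp: sym_idx_def)
qed

lemma sym_entries_nz:
  assumes "x \<in> coord_space (sym_idx a b)" "x \<noteq> 0"
  obtains i j where "sym_entries x i j \<noteq> 0"
proof -
  obtain i j where "x (i, j) \<noteq> 0"
    using assms(2) by (auto simp: fun_eq_iff)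
  moreover from this have "i \<le> j"
    using assms(1) by (auto simp: coord_space_def sym_idx_def)
  ultimately show ?thesis
    using that[of i j] by (simp add: sym_entries_def)
qed

text \<open>Cramer's rule: multiplying each unknown by the determinant eliminates the other
  one.\<close>

lemma homogeneous_2x2_trivial:
  fixes g h :: complex
  assumes "g * a + h * b = 0" "g * a' + h * b' = 0" "a * b' - a' * b \<noteq> 0"
  shows "g = 0 \<and> h = 0"
proof -
  have "g * (a * b' - a' * b) = b' * (g * a + h * b) - b * (g * a' + h * b')"
    "h * (a * b' - a' * b) = a * (g * a' + h * b') - a' * (g * a + h * b)"
    by (simp_all add: algebra_simps)
  then have "g * (a * b' - a' * b) = 0" "h * (a * b' - a' * b) = 0"
    by (simp_all only: assms(1,2)) simp_all
  then show ?thesis using assms(3) by simp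
qed

text \<open>A nonzero 2x2 minor yields two independent columns, which rank 1 forbids. Conversely an
  outer product has rank at most 1, and \<open>x \<noteq> 0\<close> supplies a nonzero
  column.\<close>

lemma rank_sym_mat_eq_1_iff:
  assumes x: "x \<in> coord_space (sym_idx a b)" "x \<noteq> 0"
  shows "vec_space.rank (b + 1 - a) (sym_mat a b x) = 1 \<longleftrightarrow> rank_le 1 (sym_entries x)"
proof -
  define N where "N = b + 1 - a"
  define M where "M = sym_mat a b x"
  interpret vec_space "TYPE(complex)" N .
  have M: "M \<in> carrier_mat N N"
    by (simp add: M_def sym_mat_def N_def)
  have entry: "M $$ (i, j) = sym_entries x (a + i) (a + j)" if "i < N" "j < N" for i j
    using that by (simp add: M_def sym_mat_def N_def sym_entries_def min_add_distrib_right max_add_distrib_right)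
  have entry': "sym_entries x i j = col M (j - a) $ (i - a)" "col M (j - a) \<in> set (cols M)" "i - a < N" "j - a < N"
    if "i \<in> {a..b}" "j \<in> {a..b}" for i j
  proof -
    show "i - a < N" "j - a < N"
      using that by (auto simp: N_def)
    then show "sym_entries x i j = col M (j - a) $ (i - a)" "col M (j - a) \<in> set (cols M)"
      using that M entry[of "i - a" "j - a"] by (auto simp: cols_def)
  qed
  have colc: "col M j \<in> carrier_vec N" if "j < N" for j
    using M that by auto
  show ?thesis
    unfolding N_def[symmetric] M_def[symmetric]
  proof
    assume r: "rank M = 1"
    show "rank_le 1 (sym_entries x)"
    proof (rule ccontr)
      assume "\<not> rank_le 1 (sym_entries x)"
      then obtain p q i j where
        nz: "sym_entries x p q * sym_entries x i j - sym_entries x i q * sym_entries x p j \<noteq> 0"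
        by (auto simp: rank_le_Suc_iff rank_le_0_iff schur_def)
      \<comment> \<open>One of the two products in the minor is nonzero, and either of them involves
        all four indices, which therefore lie in the block.\<close>
      then have "sym_entries x p q \<noteq> 0 \<and> sym_entries x i j \<noteq> 0 \<or> sym_entries x i q \<noteq> 0 \<and> sym_entries x p j \<noteq> 0"
        by auto
      then have rng: "p \<in> {a..b}" "q \<in> {a..b}" "i \<in> {a..b}" "j \<in> {a..b}"
        using sym_entries_nz_imp_range[OF x(1)] by blast+
      define c where "c = col M (q - a)"
      define d where "d = col M (j - a)"
      have nz': "c $ (p - a) * d $ (i - a) - c $ (i - a) * d $ (p - a) \<noteq> 0"
        using nz rng by (simp add: entry' c_def d_def)
      \<comment> \<open>A minor with equal columns vanishes, so \<open>{c, d}\<close> has two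
        elements and bounds the rank below by 2.\<close>
      then have cd: "c \<noteq> d" by auto
      have lt: "p - a < N" "i - a < N"
        using rng entry' by blast+
      have sub: "{c, d} \<subseteq> set (cols M)" "{c, d} \<subseteq> carrier_vec N"
        using rng entry' colc by (auto simp: c_def d_def)
      have "lin_indpt {c, d}"
      proof (rule finite_lin_indpt2)
        fix g assume "lincomb g {c, d} = 0\<^sub>v N"
        then have "g c * c $ k + g d * d $ k = 0" if "k < N" for k
          using lincomb_index[OF that sub(2), of g] cd that by simp
        from homogeneous_2x2_trivial[OF this[OF lt(1)] this[OF lt(2)] nz']
        show "\<forall>v\<in>{c, d}. g v = 0" by simp
      qed (use sub in auto)
      from rank_ge_card_indpt[OF M sub(1) this] show False
        using r cd by simp
    qed
  next
    assume "rank_le 1 (sym_entries x)"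
    then obtain u w where "\<And>i j. sym_entries x i j = u i * w j"
      by (auto elim!: rank_leE)
    then have "rank M \<le> 1"
      using M entry by (intro rank_le_1_product_entries[of M N "\<lambda>i. u (a + i)" "\<lambda>j. w (a + j)"]) auto
    moreover
    obtain i j where nz: "sym_entries x i j \<noteq> 0"
      using sym_entries_nz[OF x] .
    have rng: "i \<in> {a..b}" "j \<in> {a..b}"
      using sym_entries_nz_imp_range[OF x(1) nz] .
    define c where "c = col M (j - a)"
    have lt: "i - a < N" "c \<in> carrier_vec N" "{c} \<subseteq> set (cols M)"
      using entry' rng colc by (auto simp: c_def)
    have "lin_indpt {c}"
    proof (rule finite_lin_indpt2)
      fix g assume "lincomb g {c} = 0\<^sub>v N"
      then have "g c * c $ (i - a) = 0"
        using lincomb_index[OF lt(1), of "{c}" g] lt by simp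
      then show "\<forall>v\<in>{c}. g v = 0"
        using nz rng by (simp add: entry' c_def)
    qed (use lt in auto)
    then have "rank M \<ge> 1"
      using rank_ge_card_indpt[OF M lt(3)] by simp
    ultimately show "rank M = 1" by simp
  qed
qed

definition sym_rank_locus :: "nat \<Rightarrow> nat \<Rightarrow> nat \<Rightarrow> (nat \<times> nat \<Rightarrow> complex) set set" where
  "sym_rank_locus a b k = {P \<in> proj_space (sym_idx a b). \<forall>x\<in>P. rank_le k (sym_entries x)}"

lemma veronese_eq_sym_rank_locus: "veronese a b = sym_rank_locus a b 1"
  unfolding veronese_def sym_rank_locus_def
  using rank_sym_mat_eq_1_iff proj_spaceD(1,2) by (intro Collect_cong conj_cong ball_cong refl) blast

lemma rank_le_sym_entries_scale_fun:
  "rank_le k (sym_entries x) \<Longrightarrow> rank_le k (sym_entries (scale_fun c x))"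
  using rank_le_scale[of k "sym_entries x" c] by (simp add: sym_entries_def scale_fun_def)

lemma proj_point_in_sym_rank_locus:
  assumes "x \<in> coord_space (sym_idx a b)" "x \<noteq> 0" "rank_le k (sym_entries x)"
  shows "proj_point (sym_idx a b) x \<in> sym_rank_locus a b k"
  using assms proj_point_in_proj_space(1)[OF assms(1,2)] rank_le_sym_entries_scale_fun
  by (auto simp: sym_rank_locus_def in_proj_point_iff)

lemma zariski_closed_sym_rank_locus: "zariski_closed (sym_idx a b) (sym_rank_locus a b k)"
  unfolding sym_rank_locus_def
  by (rule zariski_closed_rank_le[of _ 1]) (auto simp: sym_entries_def intro: is_form_coord[simplified])

subsection \<open>Secant varieties of the Veronese variety\<close>

lemma sum_fun_apply: "(\<Sum>p\<in>A. f p) i = (\<Sum>p\<in>A. f p i)"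
  for f :: "'b \<Rightarrow> 'a \<Rightarrow> complex"
  by (induction A rule: infinite_finite_induct) auto

lemma subspace_coord_space: "cfun.subspace (coord_space I)"
  by (auto simp: cfun.subspace_def coord_space_def scale_fun_def)

definition unit_fun :: "'i \<Rightarrow> 'i \<Rightarrow> complex" where
  "unit_fun p = (\<lambda>q. if q = p then 1 else 0)"

lemma coord_space_expansion:
  assumes "finite I" "x \<in> coord_space I"
  shows "x = (\<Sum>p\<in>I. scale_fun (x p) (unit_fun p))"
proof
  fix i
  have "(\<Sum>p\<in>I. scale_fun (x p) (unit_fun p)) i = (\<Sum>p\<in>I. if i = p then x p else 0)"
    unfolding sum_fun_apply by (intro sum.cong) (auto simp: scale_fun_def unit_fun_def)
  then show "x i = (\<Sum>p\<in>I. scale_fun (x p) (unit_fun p)) i"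
    using assms by (auto simp: coord_space_def)
qed

text \<open>All members other than \<open>unit_fun p\<close> vanish at \<open>p\<close>, hence so
  does their span, while \<open>unit_fun p\<close> is 1 there.\<close>

lemma independent_unit_fun: "cfun.independent (unit_fun ` I)"
  unfolding cfun.dependent_def
proof (intro notI, elim bexE imageE)
  fix a p assume *: "a \<in> cfun.span (unit_fun ` I - {a})" "a = unit_fun p"
  have "cfun.span (unit_fun ` I - {a}) \<subseteq> {x. x p = 0}"
    using *(2) by (intro cfun.span_minimal) (auto simp: cfun.subspace_def scale_fun_def unit_fun_def)
  then show False
    using * by (auto simp: unit_fun_def)
qed

text \<open>Steinitz exchange against the unit functions, in both directions.\<close>

lemma card_basis_coord_space:
  assumes "finite I" "B \<subseteq> coord_space I" "cfun.independent B" "coord_space I \<subseteq> cfun.span B"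
  shows "finite B" "card B = card I"
proof -
  have inj: "inj_on unit_fun I"
    by (rule inj_onI) (metis unit_fun_def zero_neq_one)
  have "B \<subseteq> cfun.span (unit_fun ` I)"
  proof
    fix x assume "x \<in> B"
    then have "x = (\<Sum>p\<in>I. scale_fun (x p) (unit_fun p))"
      using coord_space_expansion assms by blast
    then show "x \<in> cfun.span (unit_fun ` I)"
      by (metis (mono_tags, lifting) cfun.span_sum cfun.span_scale cfun.span_base imageI)
  qed
  then have *: "finite B \<and> card B \<le> card I"
    using cfun.independent_span_bound[of "unit_fun ` I" B] assms(1,3) inj
    by (simp add: card_image)
  then show "finite B" by simp
  have "unit_fun ` I \<subseteq> cfun.span B"
    using assms(4) by (auto simp: unit_fun_def coord_space_def)
  then show "card B = card I"
    using cfun.independent_span_bound[OF \<open>finite B\<close> independent_unit_fun, of I] * inj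
    by (simp add: card_image)
qed

text \<open>A vector of \<open>U\<close> outside the span could be adjoined to \<open>B\<close>,
  giving an independent set larger than a basis of \<open>U\<close>.\<close>

lemma subset_span_if_card_eq_dim:
  assumes "B \<subseteq> U" "cfun.independent B" "finite B" "card B = cfun.dim U" "0 < card B"
  shows "U \<subseteq> cfun.span B"
proof (rule ccontr)
  assume "\<not> U \<subseteq> cfun.span B"
  then obtain x where x: "x \<in> U" "x \<notin> cfun.span B" by blast
  obtain C where C: "C \<subseteq> U" "U \<subseteq> cfun.span C" "card C = cfun.dim U"
    using cfun.basis_exists[of U] by metis
  \<comment> \<open>Infinite sets have cardinality 0, so the positivity of \<open>card B\<close>
    makes the basis \<open>C\<close> finite.\<close>
  have "finite C"
    using C(3) assms(4,5) by (auto intro: card_ge_0_finite)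
  moreover have "cfun.independent (insert x B)"
    using x assms(2) by (simp add: cfun.independent_insertI)
  moreover have "insert x B \<subseteq> cfun.span C"
    using x C(2) assms(1) by blast
  ultimately have "card (insert x B) \<le> card C"
    using cfun.independent_span_bound by blast
  moreover have "x \<notin> B"
    using x(2) cfun.span_base by blast
  ultimately show False
    using assms(3,4) C(3) by simp
qed

lemma finite_sym_idx: "finite (sym_idx a b)"
  by (rule finite_subset[of _ "{a..b} \<times> {a..b}"]) (auto simp: sym_idx_def)

lemma card_atLeastAtMost_le_sym_idx: "card {a..b} \<le> card (sym_idx a b)"
  by (rule card_inj_on_le[of "\<lambda>i. (i, i)"]) (auto simp: inj_on_def finite_sym_idx, auto simp: sym_idx_def)

section \<open>Outer squares as points of the Veronese variety\<close>

text \<open>The symmetric matrix \<open>v v^T\<close> in coordinates, that is, the Veronese map on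
  vectors.\<close>

definition veronese_vec :: "nat \<Rightarrow> nat \<Rightarrow> (nat \<Rightarrow> complex) \<Rightarrow> nat \<times> nat \<Rightarrow> complex" where
  "veronese_vec a b v = (\<lambda>(i, j). if (i, j) \<in> sym_idx a b then v i * v j else 0)"

lemma veronese_vec_in_coord_space: "veronese_vec a b v \<in> coord_space (sym_idx a b)"
  by (auto simp: veronese_vec_def coord_space_def)

lemma rank_le_veronese_vec: "rank_le 1 (sym_entries (veronese_vec a b v))"
proof -
  define w where "w i = (if i \<in> {a..b} then v i else 0)" for i
  have "sym_entries (veronese_vec a b v) = (\<lambda>i j. w i * w j)"
    by (auto simp: fun_eq_iff sym_entries_def veronese_vec_def sym_idx_def w_def min_def max_def)
  then show ?thesis
    using rank_le_outer[of 1 w w] by simp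
qed

lemma proj_point_veronese_vec:
  assumes "veronese_vec a b v \<noteq> 0"
  shows "proj_point (sym_idx a b) (veronese_vec a b v) \<in> veronese a b"
  unfolding veronese_eq_sym_rank_locus
  by (rule proj_point_in_sym_rank_locus[OF veronese_vec_in_coord_space assms rank_le_veronese_vec])

text \<open>Polarization: for \<open>i < j\<close> the unit function at \<open>(i, j)\<close> stands
  for the symmetric matrix with ones at both \<open>(i, j)\<close> and \<open>(j, i)\<close>, which
  is the square of \<open>e_i + e_j\<close> minus those of \<open>e_i\<close> and
  \<open>e_j\<close>.\<close>

lemma coord_space_subset_span_veronese_vec:
  "coord_space (sym_idx a b) \<subseteq> cfun.span (range (veronese_vec a b))"
proof
  fix x assume x: "x \<in> coord_space (sym_idx a b)"
  let ?V = "veronese_vec a b" and ?S = "cfun.span (range (veronese_vec a b))"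
  have V: "?V v \<in> ?S" for v
    by (simp add: cfun.span_base)
  have "unit_fun p \<in> ?S" if "p \<in> sym_idx a b" for p
  proof -
    obtain i j where p: "p = (i, j)" by fastforce
    have ij: "a \<le> i" "i \<le> j" "j \<le> b"
      using that by (auto simp: p sym_idx_def)
    show ?thesis
    proof (cases "i = j")
      case True
      have "unit_fun p = ?V (unit_fun i)"
        using ij by (auto simp: fun_eq_iff p True unit_fun_def veronese_vec_def sym_idx_def)
      then show ?thesis using V by simp
    next
      case False
      have "unit_fun p = ?V (\<lambda>l. unit_fun i l + unit_fun j l) - ?V (unit_fun i) - ?V (unit_fun j)"
        using ij False
        by (auto simp: fun_eq_iff p unit_fun_def veronese_vec_def sym_idx_def)
      then show ?thesis
        using V by (simp add: cfun.span_diff)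
    qed
  qed
  then have "(\<Sum>p\<in>sym_idx a b. scale_fun (x p) (unit_fun p)) \<in> ?S"
    by (intro cfun.span_sum cfun.span_scale)
  then show "x \<in> ?S"
    using coord_space_expansion[OF finite_sym_idx x] by simp
qed

lemma nondegenerate_veronese: "nondegenerate (sym_idx a b) (veronese a b)"
  unfolding nondegenerate_def
proof (intro allI impI, elim conjE)
  fix U assume U: "cfun.subspace U" "U \<subseteq> coord_space (sym_idx a b)" "\<forall>P\<in>veronese a b. P \<subseteq> U"
  have "veronese_vec a b v \<in> U" for v
  proof (cases "veronese_vec a b v = 0")
    case True
    then show ?thesis using U(1) cfun.subspace_0 by simp
  next
    case False
    have "proj_point (sym_idx a b) (veronese_vec a b v) \<subseteq> U"
      using U(3) proj_point_veronese_vec[OF False] by (rule bspec)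
    then show ?thesis
      using proj_point_in_proj_space(2)[OF veronese_vec_in_coord_space False] by (rule subsetD)
  qed
  then have "cfun.span (range (veronese_vec a b)) \<subseteq> U"
    using U(1) by (intro cfun.span_minimal) auto
  then show "U = coord_space (sym_idx a b)"
    using U(2) coord_space_subset_span_veronese_vec by blast
qed

section \<open>Secant spaces and bounded rank\<close>

lemma proj_point_subset_subspace:
  "cfun.subspace U \<Longrightarrow> x \<in> U \<Longrightarrow> proj_point I x \<subseteq> U"
  by (auto simp: in_proj_point_iff cfun.subspace_scale)

text \<open>The \<open>k\<close> independent points span the whole \<open>k\<close>-dimensional
  space \<open>U\<close>, so each vector of \<open>U\<close> is a combination of \<open>k\<close>
  matrices of rank at most 1.\<close>

lemma rank_le_of_secant_space:
  assumes k: "1 \<le> k" and "linear_space (sym_idx a b) (k - 1) \<Lambda>"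
    and "contains_indep_points (sym_idx a b) k (veronese a b \<inter> \<Lambda>)"
  shows "\<Lambda> \<subseteq> sym_rank_locus a b k"
proof -
  obtain U where U: "cfun.subspace U" "cfun.dim U = k" "\<Lambda> = {P \<in> proj_space (sym_idx a b). P \<subseteq> U}"
    using assms by (auto simp: linear_space_def)
  obtain B where B: "finite B" "card B = k" "cfun.independent B"
      "\<And>b'. b' \<in> B \<Longrightarrow> b' \<in> coord_space (sym_idx a b)"
      "\<And>b'. b' \<in> B \<Longrightarrow> proj_point (sym_idx a b) b' \<in> veronese a b \<inter> \<Lambda>"
    using assms(3) unfolding contains_indep_points_def by metis
  have mem: "b' \<in> proj_point (sym_idx a b) b'" if "b' \<in> B" for b'
    using that B(3,4) cfun.dependent_zero by (intro proj_point_in_proj_space) blast+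
  have "B \<subseteq> U"
    using mem B(5) U(3) by blast
  then have span: "U \<subseteq> cfun.span B"
    using subset_span_if_card_eq_dim[OF _ B(3,1)] B(2) U(2) k by simp
  have "rank_le 1 (sym_entries b')" if "b' \<in> B" for b'
    using mem[OF that] B(5)[OF that] by (auto simp: veronese_eq_sym_rank_locus sym_rank_locus_def)
  then have "\<exists>u w. \<forall>i j. sym_entries b' i j = u i * w j" if "b' \<in> B" for b'
    using that by (intro rank_le_1D)
  then have "\<forall>b'\<in>B. \<exists>u w. \<forall>i j. sym_entries b' i j = u i * w j"
    by blast
  then obtain u w where uw: "\<And>b' i j. b' \<in> B \<Longrightarrow> sym_entries b' i j = u b' i * w b' j"
    unfolding bchoice_iff by blast
  have "rank_le k (sym_entries x)" if "x \<in> U" for x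
  proof -
    have "x \<in> range (\<lambda>c. \<Sum>b'\<in>B. scale_fun (c b') b')"
      using that span unfolding cfun.span_finite[OF B(1)] by (rule subsetD[rotated])
    then obtain c where c: "x = (\<Sum>b'\<in>B. scale_fun (c b') b')"
      by (rule rangeE)
    have "sym_entries x i j = (\<Sum>b'\<in>B. (c b' * u b' i) * w b' j)" for i j
    proof -
      have "sym_entries x i j = (\<Sum>b'\<in>B. c b' * sym_entries b' i j)"
        by (simp add: c sym_entries_def sum_fun_apply scale_fun_def)
      also have "\<dots> = (\<Sum>b'\<in>B. (c b' * u b' i) * w b' j)"
        by (intro sum.cong) (auto simp: uw)
      finally show ?thesis .
    qed
    then show ?thesis
      using B(1,2) by (intro rank_leI[of B]) auto
  qed
  then show ?thesis
    unfolding U(3) sym_rank_locus_def by blast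
qed

text \<open>The \<open>k\<close> squares summing to \<open>x\<close> may be zero, equal or
  dependent. An independent part of them is enlarged by further squares to exactly \<open>k\<close>
  independent ones; \<open>k \<le> card (sym_idx a b)\<close> leaves room for this.\<close>

lemma in_secant_space_of_rank_le:
  assumes k: "1 \<le> k" "k \<le> card (sym_idx a b)" and P: "P \<in> sym_rank_locus a b k"
  shows "\<exists>\<Lambda>. P \<in> \<Lambda> \<and> linear_space (sym_idx a b) (k - 1) \<Lambda>
    \<and> contains_indep_points (sym_idx a b) k (veronese a b \<inter> \<Lambda>)"
proof -
  let ?I = "sym_idx a b" and ?V = "veronese_vec a b"
  have "P \<in> proj_space ?I"
    using P by (simp add: sym_rank_locus_def)
  then obtain x where x: "x \<in> coord_space ?I" "x \<noteq> 0" "P = proj_point ?I x" "x \<in> P"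
    by (rule proj_spaceE)
  have "rank_le k (sym_entries x)"
    using P x(4) by (simp add: sym_rank_locus_def)
  then obtain v where v: "\<And>i j. sym_entries x i j = (\<Sum>l<k. v l i * v l j)"
    using symmetric_rank_decomposition[where A = "sym_entries x", OF _ sym_entries_sym] by blast
  have "x = (\<Sum>l<k. ?V (v l))"
  proof
    fix p :: "nat \<times> nat"
    obtain i j where p: "p = (i, j)" by fastforce
    show "x p = (\<Sum>l<k. ?V (v l)) p"
    proof (cases "p \<in> ?I")
      case True
      then have "x p = sym_entries x i j"
        by (auto simp: p sym_entries_def sym_idx_def)
      then show ?thesis
        using True by (simp add: v sum_fun_apply veronese_vec_def p)
    next
      case False
      then show ?thesis
        using x(1) by (simp add: sum_fun_apply veronese_vec_def p coord_space_def)
    qed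
  qed
  define T where "T = (\<lambda>l. ?V (v l)) ` {..<k}"
  have "card T \<le> k"
    using card_image_le[of "{..<k}" "\<lambda>l. ?V (v l)"] by (simp add: T_def)
  have xT: "x \<in> cfun.span T"
    unfolding \<open>x = _\<close> T_def by (intro cfun.span_sum cfun.span_base) auto
  obtain B0 where B0: "B0 \<subseteq> T" "cfun.independent B0" "T \<subseteq> cfun.span B0"
    using cfun.maximal_independent_subset[of T] .
  have "card B0 \<le> k"
    using card_mono[OF _ B0(1)] \<open>card T \<le> k\<close> by (simp add: T_def)
  have "B0 \<subseteq> range ?V"
    using B0(1) by (auto simp: T_def)
  then obtain B where B: "B0 \<subseteq> B" "B \<subseteq> range ?V" "cfun.independent B" "range ?V \<subseteq> cfun.span B"
    using cfun.maximal_independent_subset_extend[OF _ B0(2)] by metis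
  have "B \<subseteq> coord_space ?I"
    using B(2) veronese_vec_in_coord_space by blast
  moreover have "coord_space ?I \<subseteq> cfun.span B"
    using coord_space_subset_span_veronese_vec B(4)
    by (meson cfun.span_minimal cfun.subspace_span order_trans)
  ultimately have "finite B" "card B = card ?I"
    using card_basis_coord_space[OF finite_sym_idx _ B(3)] by blast+
  \<comment> \<open>\<open>B\<close> is a basis of the coordinate space made of squares, so
    \<open>card B0 \<le> k \<le> card B\<close> and an intermediate set of size \<open>k\<close>
    exists.\<close>
  then obtain B1 where B1: "B0 \<subseteq> B1" "B1 \<subseteq> B" "card B1 = k"
    using exists_subset_between[OF \<open>card B0 \<le> k\<close> _ B(1)] k(2) by metis
  have indep: "cfun.independent B1"
    using B(3) B1(2) cfun.independent_mono by blast
  define \<Lambda> where "\<Lambda> = {P \<in> proj_space ?I. P \<subseteq> cfun.span B1}"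
  have sub: "proj_point ?I y \<subseteq> cfun.span B1" if "y \<in> cfun.span B1" for y
    using that by (intro proj_point_subset_subspace cfun.subspace_span)
  have "linear_space ?I (k - 1) \<Lambda>"
    unfolding linear_space_def
  proof (intro exI conjI)
    show "cfun.subspace (cfun.span B1)"
      by (rule cfun.subspace_span)
    show "cfun.span B1 \<subseteq> coord_space ?I"
      using B1(2) \<open>B \<subseteq> coord_space ?I\<close> by (intro cfun.span_minimal subspace_coord_space) auto
    show "cfun.dim (cfun.span B1) = k - 1 + 1"
      using cfun.dim_span_eq_card_independent[OF indep] B1(3) k(1) by simp
  qed (rule \<Lambda>_def)
  moreover have "contains_indep_points ?I k (veronese a b \<inter> \<Lambda>)"
    unfolding contains_indep_points_def
  proof (intro exI conjI ballI)
    show "finite B1"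
      using \<open>finite B\<close> B1(2) finite_subset by blast
    fix y assume y: "y \<in> B1"
    then obtain v where v: "y = ?V v"
      using B1(2) B(2) by blast
    have "y \<noteq> 0"
      using y indep cfun.dependent_zero by blast
    show "y \<in> coord_space ?I"
      using veronese_vec_in_coord_space v by simp
    then have "proj_point ?I y \<in> \<Lambda>"
      unfolding \<Lambda>_def using \<open>y \<noteq> 0\<close> sub y by (auto intro: proj_point_in_proj_space cfun.span_base)
    then show "proj_point ?I y \<in> veronese a b \<inter> \<Lambda>"
      using proj_point_veronese_vec \<open>y \<noteq> 0\<close> v by blast
  qed (use indep B1 in auto)
  moreover have "x \<in> cfun.span B1"
    using xT B0(3) B1(1) by (meson cfun.span_minimal cfun.span_mono cfun.subspace_span order_trans subsetD)
  then have "P \<in> \<Lambda>"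
    unfolding \<Lambda>_def using x sub by (auto intro: proj_point_in_proj_space)
  ultimately show ?thesis by blast
qed

text \<open>If there are at most \<open>k\<close> coordinates, the matrix size is at most
  \<open>k\<close> too and the rank condition is void, matching the convention. Otherwise the union
  of the secant spaces is already the rank locus, which is closed. The shift reflects that
  \<open>k\<close> points span a space of dimension \<open>k - 1\<close>.\<close>

lemma secant_variety_veronese:
  assumes k: "1 \<le> k"
  shows "secant_variety (sym_idx a b) (k - 1) (veronese a b) = sym_rank_locus a b k"
proof (cases "card (sym_idx a b) \<le> k")
  case True
  \<comment> \<open>The factorization is the identity matrix on \<open>{a..b}\<close> times the
    matrix itself.\<close>
  have "rank_le k (sym_entries x)" if "x \<in> coord_space (sym_idx a b)" for x
  proof (rule rank_leI[of "{a..b}"])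
    show "card {a..b} \<le> k"
      using card_atLeastAtMost_le_sym_idx True by (rule order_trans)
    fix i j
    have "(\<Sum>l\<in>{a..b}. (if i = l then 1 else 0) * sym_entries x l j)
        = (\<Sum>l\<in>{a..b}. if i = l then sym_entries x l j else 0)"
      by (intro sum.cong) auto
    also have "\<dots> = sym_entries x i j"
      using sym_entries_nz_imp_range(1)[OF that, of i j] by auto
    finally show "sym_entries x i j = (\<Sum>l\<in>{a..b}. (if i = l then 1 else 0) * sym_entries x l j)"
      by simp
  qed simp
  then have "sym_rank_locus a b k = proj_space (sym_idx a b)"
    using proj_spaceD(1) by (auto simp: sym_rank_locus_def)
  then show ?thesis
    using True k by (simp add: secant_variety_def nondegenerate_veronese)
next
  case False
  let ?secants = "{\<Lambda>. linear_space (sym_idx a b) (k - 1) \<Lambda> \<and>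
    contains_indep_points (sym_idx a b) k (veronese a b \<inter> \<Lambda>)}"
  have "\<Union>?secants = sym_rank_locus a b k"
  proof (rule subset_antisym)
    show "\<Union>?secants \<subseteq> sym_rank_locus a b k"
      using rank_le_of_secant_space[OF k] by (intro Union_least) simp
    have "k \<le> card (sym_idx a b)"
      using False by simp
    then show "sym_rank_locus a b k \<subseteq> \<Union>?secants"
      using in_secant_space_of_rank_le[OF k] by blast
  qed
  then show ?thesis
    using False k zariski_closure_closed[OF zariski_closed_sym_rank_locus, of a b k]
    by (simp add: secant_variety_def)
qed

subsection \<open>Images under the Cremona transformation\<close>

lemma scale_fun_project_away: "project_away n (scale_fun c y) = scale_fun c (project_away n y)"
  by (auto simp: project_away_def scale_fun_def)

lemma project_away_in_coord_space: "project_away n y \<in> coord_space (sym_idx 1 n)"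
  by (auto simp: project_away_def coord_space_def)

text \<open>Describes the cone by equations on representatives. The vertex needs no separate clause,
  since a zero block satisfies every rank bound.\<close>

definition cone_rank_locus :: "nat \<Rightarrow> nat \<Rightarrow> (nat \<times> nat \<Rightarrow> complex) set set" where
  "cone_rank_locus n m =
     {P \<in> proj_space (sym_idx 0 n). \<forall>y\<in>P. rank_le m (sym_entries (project_away n y))}"

lemma zariski_closed_cone_rank_locus: "zariski_closed (sym_idx 0 n) (cone_rank_locus n m)"
  unfolding cone_rank_locus_def
proof (rule zariski_closed_rank_le)
  fix i j
  have "is_form (sym_idx 0 n) 1 (\<lambda>x. project_away n x p)" for p
    by (cases "p \<in> sym_idx 1 n") (auto simp: project_away_def intro: is_form_coord[simplified] is_form_zero)
  then show "is_form (sym_idx 0 n) 1 (\<lambda>x. sym_entries (project_away n x) i j)"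
    by (simp add: sym_entries_def)
qed

lemma proj_point_in_cone_rank_locus:
  assumes "y \<in> coord_space (sym_idx 0 n)" "y \<noteq> 0" "rank_le m (sym_entries (project_away n y))"
  shows "proj_point (sym_idx 0 n) y \<in> cone_rank_locus n m"
  using assms proj_point_in_proj_space(1)[OF assms(1,2)] rank_le_sym_entries_scale_fun
  by (auto simp: cone_rank_locus_def in_proj_point_iff scale_fun_project_away)

lemma cone_vertex_iff:
  "P \<in> cone_vertex n \<longleftrightarrow> P \<in> proj_space (sym_idx 0 n) \<and> (\<forall>y\<in>P. project_away n y = 0)"
  by (auto simp: cone_vertex_def project_away_def fun_eq_iff sym_idx_def)

text \<open>Makes the statement about the vertex the instance \<open>m = 0\<close> of the statement
  about cones.\<close>

lemma cone_vertex_eq: "cone_vertex n = cone_rank_locus n 0"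
proof -
  have "(\<forall>i j. sym_entries (project_away n y) i j = 0) \<longleftrightarrow> project_away n y = 0" for y
    using sym_entries_nz[OF project_away_in_coord_space, of n y] by (auto simp: sym_entries_def)
  then show ?thesis
    unfolding cone_rank_locus_def by (auto simp: cone_vertex_iff rank_le_0_iff)
qed

lemma cone_over_sym_rank_locus: "cone_over n (sym_rank_locus 1 n m) = cone_rank_locus n m"
proof (rule Set.set_eqI, rule iffI)
  fix P assume P: "P \<in> cone_over n (sym_rank_locus 1 n m)"
  have "rank_le m (sym_entries (project_away n y))" if y: "y \<in> P" for y
  proof (cases "P \<in> cone_vertex n")
    case True
    then have "project_away n y = 0"
      using y by (simp add: cone_vertex_iff)
    then show ?thesis
      by (simp add: sym_entries_def rank_le_zero)
  next
    case False
    then have in_locus: "proj_point (sym_idx 1 n) (project_away n y) \<in> sym_rank_locus 1 n m"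
      using P y by (auto simp: cone_over_def)
    \<comment> \<open>\<open>proj_point\<close> of the zero vector is empty, so membership in the
      locus forces a nonzero block.\<close>
    then have "proj_point (sym_idx 1 n) (project_away n y) \<noteq> {}"
      by (auto simp: sym_rank_locus_def elim: proj_spaceE)
    then have "project_away n y \<noteq> 0"
      by (auto simp: in_proj_point_iff)
    then have "project_away n y \<in> proj_point (sym_idx 1 n) (project_away n y)"
      by (rule proj_point_in_proj_space(2)[OF project_away_in_coord_space])
    then show ?thesis
      using in_locus by (simp add: sym_rank_locus_def)
  qed
  then show "P \<in> cone_rank_locus n m"
    using P by (simp add: cone_rank_locus_def cone_over_def)
next
  fix P assume P: "P \<in> cone_rank_locus n m"
  then have PS: "P \<in> proj_space (sym_idx 0 n)"
    by (simp add: cone_rank_locus_def)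
  show "P \<in> cone_over n (sym_rank_locus 1 n m)"
  proof (cases "P \<in> cone_vertex n")
    case True
    then show ?thesis
      using PS by (simp add: cone_over_def)
  next
    case False
    then obtain z where z: "z \<in> P" "project_away n z \<noteq> 0"
      using PS by (auto simp: cone_vertex_iff)
    have "proj_point (sym_idx 1 n) (project_away n y) \<in> sym_rank_locus 1 n m" if y: "y \<in> P" for y
    proof (rule proj_point_in_sym_rank_locus[OF project_away_in_coord_space])
      show "rank_le m (sym_entries (project_away n y))"
        using P y by (simp add: cone_rank_locus_def)
      \<comment> \<open>Representatives differ by a scalar, so a nonzero block at \<open>z\<close>
        gives one at every \<open>y\<close> in \<open>P\<close>.\<close>
      have "z \<in> proj_point (sym_idx 0 n) y"
        using z(1) proj_spaceD(3)[OF PS y] by simp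
      then obtain c where "z = scale_fun c y"
        by (auto simp: in_proj_point_iff)
      then show "project_away n y \<noteq> 0"
        using z(2) by (auto simp: scale_fun_project_away)
    qed
    then show ?thesis
      using PS by (simp add: cone_over_def)
  qed
qed

section \<open>The Cremona map and its inverse in matrix form\<close>

lemma coord_space_0: "x \<in> coord_space (sym_idx 0 n) \<Longrightarrow> n < j \<Longrightarrow> x (i, j) = 0"
  by (simp add: coord_space_def sym_idx_def)

lemma cremona_in_coord_space: "cremona n x \<in> coord_space (sym_idx 0 n)"
  by (auto simp: cremona_def coord_space_def)

lemma cremona_inv_in_coord_space: "cremona_inv n x \<in> coord_space (sym_idx 0 n)"
  by (auto simp: cremona_inv_def coord_space_def)

lemma cremona_00: "cremona n x (0, 0) = x (0, 0) * x (0, 0)"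
  and cremona_inv_00: "cremona_inv n x (0, 0) = x (0, 0) * x (0, 0)"
  by (simp_all add: cremona_def cremona_inv_def sym_idx_def)

text \<open>Both sides vanish on row and column 0; elsewhere the quadratic formula is the 2x2 minor
  with pivot \<open>x (0, 0)\<close>.\<close>

lemma sym_entries_project_away_cremona:
  assumes "x \<in> coord_space (sym_idx 0 n)"
  shows "sym_entries (project_away n (cremona n x)) = schur 0 0 (sym_entries x)"
proof (intro ext)
  fix i j
  show "sym_entries (project_away n (cremona n x)) i j = schur 0 0 (sym_entries x) i j"
    using coord_space_0[OF assms]
    by (cases "i \<le> j")
       (auto simp: sym_entries_def schur_def project_away_def cremona_def sym_idx_def min_def max_def not_le)
qed

text \<open>The inverse map adds the outer square of row 0 to a multiple of the block, so it raises
  the rank bound by at most one.\<close>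

lemma sym_entries_cremona_inv:
  assumes "y \<in> coord_space (sym_idx 0 n)"
  shows "sym_entries (cremona_inv n y) =
    (\<lambda>i j. y (0, 0) * sym_entries (project_away n y) i j + sym_entries y 0 i * sym_entries y 0 j)"
proof (intro ext)
  fix i j
  show "sym_entries (cremona_inv n y) i j =
      y (0, 0) * sym_entries (project_away n y) i j + sym_entries y 0 i * sym_entries y 0 j"
    using coord_space_0[OF assms]
    by (cases "i \<le> j")
       (auto simp: sym_entries_def project_away_def cremona_inv_def sym_idx_def min_def max_def not_le)
qed

lemma cremona_image_point_in_cone_rank_locus:
  assumes "P \<in> sym_rank_locus 0 n (Suc m)" "x \<in> P" "x (0, 0) \<noteq> 0"
  shows "proj_point (sym_idx 0 n) (cremona n x) \<in> cone_rank_locus n m"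
proof (rule proj_point_in_cone_rank_locus[OF cremona_in_coord_space])
  have x: "x \<in> coord_space (sym_idx 0 n)" "rank_le (Suc m) (sym_entries x)"
    using assms(1,2) proj_spaceD(1) by (auto simp: sym_rank_locus_def)
  show "cremona n x \<noteq> 0"
    using cremona_00[of n x] assms(3) by auto
  show "rank_le m (sym_entries (project_away n (cremona n x)))"
    unfolding sym_entries_project_away_cremona[OF x(1)]
    using x(2) assms(3) by (intro rank_le_schur) (auto simp: sym_entries_def)
qed

text \<open>The preimage is \<open>cremona_inv n y\<close>; applying \<open>cremona n\<close>
  returns \<open>y\<close> up to the factor \<open>y (0, 0) ^ 3\<close>, which is nonzero on this
  chart.\<close>

lemma cone_rank_locus_point_is_cremona_image:
  assumes y: "y \<in> coord_space (sym_idx 0 n)" "y (0, 0) \<noteq> 0"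
    and r: "rank_le m (sym_entries (project_away n y))"
  shows "\<exists>P x. proj_point (sym_idx 0 n) y = proj_point (sym_idx 0 n) (cremona n x)
    \<and> P \<in> sym_rank_locus 0 n (Suc m) \<and> x \<in> P \<and> x (0, 0) \<noteq> 0"
proof (intro exI conjI)
  let ?x = "cremona_inv n y"
  show x00: "?x (0, 0) \<noteq> 0"
    using y(2) by (simp add: cremona_inv_00)
  then have nz: "?x \<noteq> 0" by auto
  have "y \<noteq> 0" using y(2) by auto
  then show "proj_point (sym_idx 0 n) y = proj_point (sym_idx 0 n) (cremona n ?x)"
    unfolding cremona_birational(2)[OF y(1)] using y by (simp add: proj_point_scale_fun)
  show "?x \<in> proj_point (sym_idx 0 n) ?x"
    by (rule proj_point_in_proj_space(2)[OF cremona_inv_in_coord_space nz])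
  have "rank_le (Suc m) (sym_entries ?x)"
    unfolding sym_entries_cremona_inv[OF y(1)] by (intro rank_le_add_outer rank_le_scale r)
  then show "proj_point (sym_idx 0 n) ?x \<in> sym_rank_locus 0 n (Suc m)"
    by (rule proj_point_in_sym_rank_locus[OF cremona_inv_in_coord_space nz])
qed

text \<open>Points of the cone with \<open>y\<^sub>0\<^sub>0 = 0\<close> are limits of the points \<open>y + t e\<^sub>0\<^sub>0\<close>, which stay in the cone
  because its equations do not involve \<open>y\<^sub>0\<^sub>0\<close>, and which lie in the image for \<open>t \<noteq> 0\<close>.\<close>

lemma cremona_image_sym_rank_locus:
  "cremona_image n (sym_rank_locus 0 n (Suc m)) = cone_rank_locus n m"
  unfolding cremona_image_def
proof (rule zariski_closure_eqI[OF _ zariski_closed_cone_rank_locus])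
  let ?I = "sym_idx 0 n"
  let ?X = "{proj_point ?I (cremona n x) | P x. P \<in> sym_rank_locus 0 n (Suc m) \<and> x \<in> P \<and> x (0, 0) \<noteq> 0}"
  show "?X \<subseteq> cone_rank_locus n m"
    using cremona_image_point_in_cone_rank_locus by blast
  fix T assume "zariski_closed ?I T" and XT: "?X \<subseteq> T"
  then obtain F where T: "T = {P \<in> proj_space ?I. \<forall>p\<in>F. \<forall>x\<in>P. cpoly_eval p x = 0}"
    unfolding zariski_closed_def by blast
  \<comment> \<open>On the chart \<open>y (0, 0) \<noteq> 0\<close> every point of the cone is an
    actual image point, hence lies in \<open>T\<close>.\<close>
  have open_part: "cpoly_eval p y = 0"
    if "p \<in> F" "y \<in> coord_space ?I" "y (0, 0) \<noteq> 0" "rank_le m (sym_entries (project_away n y))" for p y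
  proof -
    have "proj_point ?I y \<in> T"
      using cone_rank_locus_point_is_cremona_image[OF that(2-4)] XT by blast
    moreover have "y \<in> proj_point ?I y"
      using that(2,3) by (intro proj_point_in_proj_space) auto
    ultimately show ?thesis
      using that(1) by (auto simp: T)
  qed
  show "cone_rank_locus n m \<subseteq> T"
  proof
    fix P assume P: "P \<in> cone_rank_locus n m"
    then have PS: "P \<in> proj_space ?I"
      by (simp add: cone_rank_locus_def)
    have "cpoly_eval p y = 0" if "p \<in> F" "y \<in> P" for p y
    proof (cases "y (0, 0) = 0")
      case False
      then show ?thesis
        using open_part that P proj_spaceD(1)[OF PS] by (auto simp: cone_rank_locus_def)
    next
      case True
      define f where "f t = cpoly_eval p (\<lambda>i. y i + t * unit_fun (0, 0) i)" for t
      have f0: "f t = 0" if "t \<noteq> 0" for t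
        unfolding f_def
      proof (rule open_part[OF \<open>p \<in> F\<close>])
        let ?y = "\<lambda>i. y i + t * unit_fun (0, 0) i"
        show "?y \<in> coord_space ?I"
          using proj_spaceD(1)[OF PS \<open>y \<in> P\<close>] by (auto simp: coord_space_def unit_fun_def sym_idx_def)
        show "?y (0, 0) \<noteq> 0"
          using True that by (simp add: unit_fun_def)
        have "project_away n ?y = project_away n y"
          by (auto simp: project_away_def unit_fun_def sym_idx_def fun_eq_iff)
        then show "rank_le m (sym_entries (project_away n ?y))"
          using P \<open>y \<in> P\<close> by (simp add: cone_rank_locus_def)
      qed
      \<comment> \<open>\<open>f\<close> is continuous and vanishes away from 0, so uniqueness of
        limits gives \<open>f 0 = 0\<close>.\<close>
      have "f \<midarrow>0\<rightarrow> f 0"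
        using isCont_cpoly_eval_line[where p = p and y = y and e = "unit_fun (0, 0)" and t = 0] unfolding f_def[symmetric] isCont_def .
      moreover have "f \<midarrow>0\<rightarrow> 0"
        by (rule tendsto_eventually) (auto simp: eventually_at_filter f0)
      ultimately have "f 0 = 0"
        by (rule LIM_unique)
      then show ?thesis by (simp add: f_def)
    qed
    then show "P \<in> T"
      using PS by (simp add: T)
  qed
qed

theorem mainTheorem3:
  fixes n k :: nat
  assumes "n \<ge> 1" and "k \<ge> 2"
  shows "cremona_image n (secant_variety (sym_idx 0 n) (k - 1) (veronese 0 n)) =
           cone_over n (secant_variety (sym_idx 1 n) (k - 2) (veronese 1 n))
       \<and> cremona_image n (veronese 0 n) = cone_vertex n"
proof
  \<comment> \<open>Rank at most \<open>k\<close> drops to rank at most \<open>k - 1\<close>, which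
    belongs to the secant index \<open>(k - 1) - 1\<close>; \<open>k \<ge> 2\<close> makes
    \<open>k - 1\<close> positive, as the rank description of that secant variety requires.\<close>
  have k: "k = Suc (k - 1)" "k - 2 = (k - 1) - 1" "1 \<le> k - 1" "1 \<le> k"
    using assms(2) by auto
  have "cremona_image n (secant_variety (sym_idx 0 n) (k - 1) (veronese 0 n)) = cone_rank_locus n (k - 1)"
    unfolding secant_variety_veronese[OF k(4)]
    by (subst k(1)) (rule cremona_image_sym_rank_locus)
  also have "\<dots> = cone_over n (secant_variety (sym_idx 1 n) (k - 2) (veronese 1 n))"
    unfolding k(2) secant_variety_veronese[OF k(3)] cone_over_sym_rank_locus ..
  finally show "cremona_image n (secant_variety (sym_idx 0 n) (k - 1) (veronese 0 n)) =
      cone_over n (secant_variety (sym_idx 1 n) (k - 2) (veronese 1 n))" .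
  show "cremona_image n (veronese 0 n) = cone_vertex n"
    \<comment> \<open>The case \<open>m = 0\<close>: rank at most 1 is the Veronese variety, and a
      block of rank 0 is the vertex.\<close>
    using cremona_image_sym_rank_locus[of n 0]
    by (simp add: veronese_eq_sym_rank_locus cone_vertex_eq)
qed

end
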